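(* Let $\mathbb{F}=\mathbb{R}$ or $\mathbb{C}$, let $n \geq 1$ and let $R \subset \mathbb{F}^n\times \mathbb{F}^n$ be a linorder. Let $\mathcal{V}_R = \mathrm{span}\{wv^* : (v,w)\in R\} \subseteq M_n(\mathbb{F})$. Then the minimum size of a coherent decomposition of $\mathbb{F}^n$ into chains relative to $\mathcal{V}_R$ equals the maximum dimension of an antichain for $R$.
   Context: Orthogonality $\perp$ is with respect to the standard inner product on $\mathbb{F}^n$, and $wv^*$ is the linear map $u \mapsto \langle u,v\rangle w$. A linorder is a relation $R \subset \mathbb{F}^n \times \mathbb{F}^n$ such that (1) if $(v,w)$ and $(\tilde v,\tilde w)$ both belong to $R$ and $w \not\perp \tilde v$, then $(v,\tilde w) \in R$; (2) $(v,w) \in R$ implies $v \perp w$. Given a linear subspace $\mathcal{V} \subseteq M_n(\mathbb{F})$, a coherent chain in $\mathbb{F}^n$ relative to $\mathcal{V}$ is a sequence of the form $(v, Av, \ldots, A^{k-1}v)$ ($k \geq 1$) for some $v \in \mathbb{F}^n$ and some $A \in \mathcal{V}$. A coherent decomposition of $\mathbb{F}^n$ into chains relative to $\mathcal{V}$ is a collection of coherent chains which are all implemented by one single $A \in \mathcal{V}$ and whose elements collectively form a basis of $\mathbb{F}^n$. Its size is the number of coherent chains in the collection. An antichain for $R$ is a linear subspace $C$ of $\mathbb{F}^n$ such that every $(v,w) \in R$ satisfies $v \perp C$ or $w \perp C$ (or both). *)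

theory Defs
  imports "HOL-Analysis.Analysis" "Jordan_Normal_Form.Conjugate"
begin

text \<open>
  The scalars range over a field with conjugation, so that each notion is defined once and can be
  used for both \<open>real\<close> (where \<open>conjugate\<close> is the identity) and \<open>complex\<close> (where it is \<open>cnj\<close>).
\<close>

text \<open>Linear in the first argument, conjugate-linear in the second. On complex vectors the
  library's \<open>inner\<close> is only the real part of this.\<close>

definition std_inner :: "'a::conjugatable_field ^ 'n \<Rightarrow> 'a ^ 'n \<Rightarrow> 'a" where
  "std_inner u v = (\<Sum>i\<in>UNIV. u $ i * conjugate (v $ i))"

definition perp :: "'a::conjugatable_field ^ 'n \<Rightarrow> 'a ^ 'n \<Rightarrow> bool" where
  "perp u v \<longleftrightarrow> std_inner u v = 0"

lemma std_inner_real: "std_inner u v = inner u (v :: real ^ 'n)"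
  by (simp add: std_inner_def inner_vec_def)

text \<open>The matrix of the linear map \<open>w v*\<close>.\<close>

definition outer :: "'a::conjugatable_field ^ 'n \<Rightarrow> 'a ^ 'n \<Rightarrow> 'a ^ 'n ^ 'n" where
  "outer w v = (\<chi> i j. w $ i * conjugate (v $ j))"

lemma outer_mult_vec: "outer w v *v u = std_inner u v *s w"
  by (simp add: vec_eq_iff outer_def std_inner_def matrix_vector_mult_def sum_distrib_left mult_ac)

definition mat_scale :: "'a::field \<Rightarrow> 'a ^ 'n ^ 'n \<Rightarrow> 'a ^ 'n ^ 'n" where
  "mat_scale c A = (\<chi> i j. c * A $ i $ j)"

interpretation mat_vs: vector_space "mat_scale :: 'a::field \<Rightarrow> 'a ^ 'n ^ 'n \<Rightarrow> 'a ^ 'n ^ 'n"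
  by unfold_locales (simp_all add: vec_eq_iff mat_scale_def algebra_simps)

definition is_linorder :: "(('a::conjugatable_field ^ 'n) \<times> ('a ^ 'n)) set \<Rightarrow> bool" where
  "is_linorder R \<longleftrightarrow>
     (\<forall>v w v' w'. (v, w) \<in> R \<and> (v', w') \<in> R \<and> \<not> perp w v' \<longrightarrow> (v, w') \<in> R) \<and>
     (\<forall>v w. (v, w) \<in> R \<longrightarrow> perp v w)"

definition linorder_space :: "(('a::conjugatable_field ^ 'n) \<times> ('a ^ 'n)) set \<Rightarrow> ('a ^ 'n ^ 'n) set" where
  "linorder_space R = mat_vs.span {outer w v |v w. (v, w) \<in> R}"

text \<open>The sequence \<open>c = (v, Av, ..., A^(k-1) v)\<close> for some \<open>v\<close> and some \<open>k \<ge> 1\<close>.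
  There is no requirement that \<open>A^k v = 0\<close>.\<close>

definition chain_implemented_by :: "'a::field ^ 'n ^ 'n \<Rightarrow> ('a ^ 'n) list \<Rightarrow> bool" where
  "chain_implemented_by A c \<longleftrightarrow> (\<exists>v k. k \<ge> 1 \<and> c = map (\<lambda>i. ((*v) A ^^ i) v) [0..<k])"

definition coherent_chain :: "('a::field ^ 'n ^ 'n) set \<Rightarrow> ('a ^ 'n) list \<Rightarrow> bool" where
  "coherent_chain V c \<longleftrightarrow> (\<exists>A\<in>V. chain_implemented_by A c)"

text \<open>The collection of chains is a list, so its size is its length. Distinctness of the
  concatenation says that the elements form a basis as a family: no vector is used twice, within
  one chain or in two different ones.\<close>

definition coherent_decomposition :: "('a::field ^ 'n ^ 'n) set \<Rightarrow> ('a ^ 'n) list list \<Rightarrow> bool" where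
  "coherent_decomposition V cs \<longleftrightarrow>
     (\<forall>c\<in>set cs. coherent_chain V c) \<and>
     (\<exists>A\<in>V. \<forall>c\<in>set cs. chain_implemented_by A c) \<and>
     distinct (concat cs) \<and>
     vec.independent (set (concat cs)) \<and> vec.span (set (concat cs)) = UNIV"

definition antichain :: "(('a::conjugatable_field ^ 'n) \<times> ('a ^ 'n)) set \<Rightarrow> ('a ^ 'n) set \<Rightarrow> bool" where
  "antichain R C \<longleftrightarrow> vec.subspace C \<and>
     (\<forall>(v, w)\<in>R. (\<forall>c\<in>C. perp v c) \<or> (\<forall>c\<in>C. perp w c))"

end

theory Submission
  imports Defs
begin

text \<open>
  Every matrix \<open>A\<close> of the space of a linorder is nilpotent, so a Jordan basis is a decomposition
  into \<open>n - rank A\<close> chains, and no decomposition implemented by \<open>A\<close> has fewer. Hence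
  the minimum size is \<open>n - r\<close>, where \<open>r\<close> is the maximal rank in the space. As the space is
  spanned by the matrices \<open>w v\<^sup>*\<close>, matroid intersection for the families of the \<open>v\<close> and of the \<open>w\<close>
  yields a matrix of rank \<open>r\<close> and subspaces \<open>X\<close>, \<open>Y\<close> with \<open>dim X + dim Y = r\<close> such that \<open>v \<in> X\<close> or
  \<open>w \<in> Y\<close> for each pair. Then \<open>(X + Y)\<^sup>\<perp>\<close> is an antichain of dimension at least \<open>n - r\<close>.
  Conversely, transitivity implies \<open>rank A + dim C \<le> n\<close> for every antichain \<open>C\<close>.
\<close>

section \<open>Orthogonality\<close>

lemma std_inner_add_left: "std_inner (x + y) z = std_inner x z + std_inner y z"
  by (simp add: std_inner_def distrib_right sum.distrib)

lemma std_inner_diff_left: "std_inner (x - y) z = std_inner x z - std_inner y z"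
  by (simp add: std_inner_def left_diff_distrib sum_subtractf)

lemma std_inner_scale_left: "std_inner (c *s x) z = c * std_inner x z"
  by (simp add: std_inner_def sum_distrib_left mult_ac)

lemma std_inner_zero_left [simp]: "std_inner 0 z = 0"
  by (simp add: std_inner_def)

lemma std_inner_commute: "std_inner y x = conjugate (std_inner x y)"
  by (simp add: std_inner_def sum_conjugate conjugate_dist_mul mult.commute)

lemma perp_commute: "perp x y \<longleftrightarrow> perp y x"
  unfolding perp_def by (subst std_inner_commute) simp

text \<open>Positive definiteness; it is through this lemma that the order of the scalars
  enters.\<close>

lemma perp_self_iff: "perp x x \<longleftrightarrow> x = (0 :: 'a::conjugatable_ordered_field ^ 'n)"
  by (auto simp: perp_def std_inner_def vec_eq_iff sum_nonneg_eq_0_iff conjugate_square_positive)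

definition orth :: "('a::conjugatable_field ^ 'n) set \<Rightarrow> ('a ^ 'n) set" where
  "orth S = {x. \<forall>s\<in>S. perp x s}"

lemma subspace_perp: "vec.subspace {x. perp x s}"
  by (auto simp: vec.subspace_def perp_def std_inner_add_left std_inner_scale_left)

lemma orth_Inter: "orth S = (\<Inter>s\<in>S. {x. perp x s})"
  by (auto simp: orth_def)

lemma subspace_orth: "vec.subspace (orth S)"
  unfolding orth_Inter by (rule vec.subspace_Inter) (auto simp: subspace_perp)

lemma orth_span: "orth (vec.span S) = orth S"
proof
  show "orth S \<subseteq> orth (vec.span S)"
  proof
    fix x assume x: "x \<in> orth S"
    have "vec.span S \<subseteq> {y. perp y x}"
      using x by (intro vec.span_minimal subspace_perp) (auto simp: orth_def perp_commute)
    then show "x \<in> orth (vec.span S)" by (auto simp: orth_def perp_commute)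
  qed
qed (auto simp: orth_def vec.span_base)

text \<open>One linear condition costs at most one dimension: if \<open>y\<close> in
  \<open>W\<close> is not orthogonal to \<open>s\<close>, subtracting a suitable multiple of
  \<open>y\<close> makes any \<open>x\<close> in \<open>W\<close> orthogonal to
  \<open>s\<close>.\<close>

lemma dim_Int_perp:
  assumes W: "vec.subspace W"
  shows "vec.dim W \<le> Suc (vec.dim (W \<inter> {x. perp x s}))"
proof (cases "W \<subseteq> {x. perp x s}")
  case True
  then show ?thesis by (simp add: Int_absorb2)
next
  case False
  then obtain y where y: "y \<in> W" "std_inner y s \<noteq> 0" by (auto simp: perp_def)
  have "W \<subseteq> vec.span (insert y (W \<inter> {x. perp x s}))"
  proof
    fix x assume x: "x \<in> W"
    let ?c = "std_inner x s / std_inner y s"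
    have "x - ?c *s y \<in> W" using x y W by (simp add: vec.subspace_diff vec.subspace_scale)
    moreover have "perp (x - ?c *s y) s"
      using y(2) by (simp add: perp_def std_inner_diff_left std_inner_scale_left)
    ultimately show "x \<in> vec.span (insert y (W \<inter> {x. perp x s}))"
      unfolding vec.span_insert by (auto intro!: exI[of _ ?c] vec.span_base)
  qed
  then have "vec.dim W \<le> vec.dim (insert y (W \<inter> {x. perp x s}))"
    by (rule vec.dim_mono)
  then show ?thesis by (simp add: vec.dim_insert split: if_splits)
qed

lemma dim_orth_ge:
  fixes D :: "('a::conjugatable_field ^ 'n) set"
  shows "CARD('n) \<le> vec.dim (orth D) + vec.dim D"
proof -
  have *: "CARD('n) \<le> vec.dim (orth B) + card B" if "finite B" for B :: "('a ^ 'n) set"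
    using that
  proof induction
    case empty
    then show ?case by (simp add: orth_def vec_dim_card card_cart_basis)
  next
    case (insert b B)
    have "orth (insert b B) = orth B \<inter> {x. perp x b}" by (auto simp: orth_def)
    then show ?case using insert dim_Int_perp[OF subspace_orth, of B b] by simp
  qed
  obtain B where B: "B \<subseteq> D" "vec.independent B" "D \<subseteq> vec.span B" "card B = vec.dim D"
    using vec.basis_exists by blast
  have "orth B \<subseteq> orth D" using B(3) orth_span[of B] by (auto simp: orth_def)
  then have "vec.dim (orth B) \<le> vec.dim (orth D)" by (rule vec.dim_subset)
  then show ?thesis using *[of B] B vec.finiteI_independent by fastforce
qed

lemma dim_orthogonal_add:
  fixes S T :: "('a::conjugatable_ordered_field ^ 'n) set"
  assumes "vec.subspace S" "vec.subspace T" and "T \<subseteq> orth S"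
  shows "vec.dim {x + y |x y. x \<in> S \<and> y \<in> T} = vec.dim S + vec.dim T"
proof -
  have "S \<inter> T = {0}"
    using assms vec.subspace_0 perp_self_iff unfolding orth_def by blast
  then show ?thesis using vec.dim_sums_Int[OF assms(1,2)] by simp
qed

section \<open>Ranks and kernels\<close>

text \<open>Rank-nullity on \<open>W\<close>: a basis \<open>K\<close> of the kernel in
  \<open>W\<close> is extended to a basis of \<open>W\<close>, and \<open>A\<close> is injective on
  the span \<open>M\<close> of the added vectors.\<close>

lemma dim_image_add_kernel:
  fixes A :: "'a::field ^ 'n ^ 'm"
  assumes W: "vec.subspace W"
  shows "vec.dim ((*v) A ` W) + vec.dim {x \<in> W. A *v x = 0} = vec.dim W"
proof -
  define N where "N = {x \<in> W. A *v x = 0}"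
  have N: "vec.subspace N" "N \<subseteq> W"
    using W by (auto simp: N_def vec.subspace_def vec.add vec.scale)
  obtain K where K: "K \<subseteq> N" "vec.independent K" "N \<subseteq> vec.span K" "card K = vec.dim N"
    using vec.basis_exists by blast
  obtain B where B: "K \<subseteq> B" "B \<subseteq> W" "vec.independent B" "W \<subseteq> vec.span B"
    using vec.maximal_independent_subset_extend[of K W] K N by blast
  have fin: "finite B" using B vec.finiteI_independent by blast
  define M where "M = vec.span (B - K)"
  have M: "vec.subspace M" unfolding M_def by (rule vec.subspace_span)
  have MW: "M \<subseteq> W" unfolding M_def using B(2) by (intro vec.span_minimal W) auto
  have NK: "vec.span K = N" using K N by (simp add: vec.span_subspace)
  have "W = vec.span (K \<union> (B - K))" using B W vec.span_subspace[of B W] by (simp add: Un_absorb1)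
  then have sums: "W = {x + y |x y. x \<in> N \<and> y \<in> M}" by (simp only: vec.span_Un M_def NK)
  have dM: "vec.dim M = card (B - K)" unfolding M_def
    using B vec.dim_span_eq_card_independent vec.independent_mono[of B] by blast
  have "vec.dim W = card B" using B vec.basis_card_eq_dim by metis
  then have "vec.dim N + vec.dim M = vec.dim W"
    using K(4) B(1) fin dM card_mono[OF fin B(1)] by (simp add: card_Diff_subset finite_subset)
  then have "vec.dim (N \<inter> M) = 0" using vec.dim_sums_Int[OF N(1) M] sums by simp
  then have int: "N \<inter> M \<subseteq> {0}" by simp
  have spanM: "vec.span M = M" using M by (simp only: vec.span_eq_iff)
  have inj: "inj_on ((*v) A) (vec.span M)"
    unfolding spanM vec.inj_on_iff_eq_0[OF M] using int MW by (auto simp: N_def)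
  have "(*v) A ` W = (*v) A ` M"
  proof
    show "(*v) A ` W \<subseteq> (*v) A ` M"
    proof
      fix y assume "y \<in> (*v) A ` W"
      then obtain a b where "a \<in> N" "b \<in> M" "y = A *v (a + b)" using sums by blast
      then show "y \<in> (*v) A ` M" by (simp add: N_def vec.add)
    qed
    show "(*v) A ` M \<subseteq> (*v) A ` W" using MW by (rule image_mono)
  qed
  then have "vec.dim ((*v) A ` W) = vec.dim M"
    using vec.dim_image_eq[OF _ inj] by simp
  then show ?thesis using \<open>vec.dim N + vec.dim M = vec.dim W\<close> by (simp add: N_def)
qed

lemma dim_range_le:
  fixes A :: "'a::field ^ 'n ^ 'm"
  assumes "vec.subspace W" and "(*v) A ` W \<subseteq> U"
  shows "vec.dim (range ((*v) A)) + vec.dim W \<le> vec.dim U + CARD('n)"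
proof -
  have "vec.dim ((*v) A ` W) \<le> vec.dim U" using assms(2) by (rule vec.dim_subset)
  moreover have "vec.dim {x \<in> W. A *v x = 0} \<le> vec.dim {x \<in> UNIV. A *v x = 0}"
    by (rule vec.dim_subset) auto
  moreover have "vec.dim (UNIV :: ('a ^ 'n) set) = CARD('n)" 
    by (simp add: vec_dim_card card_cart_basis)
  ultimately show ?thesis
    using dim_image_add_kernel[OF assms(1), of A] dim_image_add_kernel[of UNIV A] by simp
qed

section \<open>Jordan chains of a nilpotent matrix\<close>

text \<open>A pair \<open>(v, k)\<close> stands for the chain \<open>v, A v, \<dots>, A\<^sup>k\<^sup>-\<^sup>1 v\<close>. The chains of \<open>A W\<close> are
  prolonged by preimages of their first vectors, and their last vectors are completed to a basis
  of the kernel in \<open>W\<close> by chains of length one.\<close>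

lemma nilpotent_chain_basis:
  fixes A :: "'a::field ^ 'n ^ 'n"
  assumes "vec.subspace W" and "(*v) A ` W \<subseteq> W"
    and nil: "\<And>U. vec.subspace U \<Longrightarrow> (*v) A ` U = U \<Longrightarrow> U \<subseteq> {0}"
  shows "\<exists>ps. (\<forall>(v, k)\<in>set ps. k \<ge> 1) \<and>
     vec.span (\<Union>(v, k)\<in>set ps. (\<lambda>i. ((*v) A ^^ i) v) ` {..<k}) = W \<and>
     vec.span ((\<lambda>(v, k). ((*v) A ^^ (k - 1)) v) ` set ps) = {x \<in> W. A *v x = 0} \<and>
     length ps \<le> vec.dim {x \<in> W. A *v x = 0} \<and>
     sum_list (map snd ps) \<le> vec.dim W"
  using assms(1,2)
proof (induction "vec.dim W" arbitrary: W rule: less_induct)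
  case less
  note W = less.prems
  show ?case
  proof (cases "W \<subseteq> {0}")
    case True
    then have "W = {0}" using W vec.subspace_0 by blast
    then show ?thesis by (intro exI[of _ "[]"]) auto
  next
    case False
    define W' where "W' = (*v) A ` W"
    define N where "N = {x \<in> W. A *v x = 0}"
    define N' where "N' = {x \<in> W'. A *v x = 0}"
    have W': "vec.subspace W'" "W' \<subseteq> W" "(*v) A ` W' \<subseteq> W'"
      using W vec.subspace_image[of W A] by (auto simp: W'_def)
    have N: "vec.subspace N" using W by (auto simp: N_def vec.subspace_def vec.add vec.scale)
    \<comment> \<open>\<open>nil\<close> forbids \<open>A W = W\<close>, so the dimension drops and
      the induction hypothesis applies to \<open>W'\<close>.\<close>
    have "W' \<noteq> W" using nil[OF W(1)] False by (auto simp: W'_def)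
    then have "vec.dim W' < vec.dim W"
      using W' W vec.subspace_dim_equal[of W' W] by fastforce
    from less.hyps[OF this W'(1,3)] obtain ps where
      ps1: "\<forall>(v, k)\<in>set ps. k \<ge> 1" and
      ps2: "vec.span (\<Union>(v, k)\<in>set ps. (\<lambda>i. ((*v) A ^^ i) v) ` {..<k}) = W'" and
      ps3: "vec.span ((\<lambda>(v, k). ((*v) A ^^ (k - 1)) v) ` set ps) = N'" and
      ps4: "length ps \<le> vec.dim N'" and
      ps5: "sum_list (map snd ps) \<le> vec.dim W'"
      unfolding N'_def by blast
    have mem: "((*v) A ^^ i) v \<in> W'" if "(v, k) \<in> set ps" "i < k" for v k i
      unfolding ps2[symmetric] using that by (intro vec.span_base) auto
    have "\<forall>v\<in>fst ` set ps. \<exists>u. u \<in> W \<and> A *v u = v"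
    proof
      fix v assume "v \<in> fst ` set ps"
      then obtain k where k: "(v, k) \<in> set ps" by auto
      then have "v \<in> W'" using mem[OF k, of 0] ps1 by fastforce
      then show "\<exists>u. u \<in> W \<and> A *v u = v" by (auto simp: W'_def)
    qed
    from bchoice[OF this] obtain u where "\<forall>v\<in>fst ` set ps. u v \<in> W \<and> A *v u v = v" by blast
    then have u: "u v \<in> W \<and> A *v u v = v" if "(v, k) \<in> set ps" for v k
      using that by force
    have shift: "((*v) A ^^ Suc i) (u v) = ((*v) A ^^ i) v" if "(v, k) \<in> set ps" for v k i
      using u[OF that] by (simp add: funpow_swap1)
    obtain Z where Z: "finite Z" "Z \<subseteq> N" "vec.span (N' \<union> Z) = N" "card Z + vec.dim N' \<le> vec.dim N"
    proof -
      obtain K where K: "K \<subseteq> N'" "vec.independent K" "N' \<subseteq> vec.span K" "card K = vec.dim N'"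
        using vec.basis_exists by blast
      have sub: "N' \<subseteq> N" using W' by (auto simp: N_def N'_def)
      obtain B where B: "K \<subseteq> B" "B \<subseteq> N" "vec.independent B" "N \<subseteq> vec.span B"
        using vec.maximal_independent_subset_extend[of K N] K sub by blast
      have fin: "finite B" using B vec.finiteI_independent by blast
      show thesis
      proof
        show "finite (B - K)" "B - K \<subseteq> N" using fin B by auto
        show "vec.span (N' \<union> (B - K)) = N"
        proof
          show "vec.span (N' \<union> (B - K)) \<subseteq> N"
            using B sub by (intro vec.span_minimal N) auto
          have "B \<subseteq> N' \<union> (B - K)" using K by auto
          then show "N \<subseteq> vec.span (N' \<union> (B - K))" using B vec.span_mono by blast
        qed
        have "card B = vec.dim N" using B vec.basis_card_eq_dim by metis
        then show "card (B - K) + vec.dim N' \<le> vec.dim N"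
          using K(4) B(1) fin card_mono[OF fin B(1)] by (simp add: card_Diff_subset finite_subset)
      qed
    qed
    obtain zs where zs: "set zs = Z" "length zs = card Z"
      using finite_distinct_list[OF Z(1)] distinct_card by metis
    define qs where "qs = map (\<lambda>(v, k). (u v, Suc k)) ps @ map (\<lambda>z. (z, 1)) zs"
    define T where "T = (\<Union>(v, k)\<in>set qs. (\<lambda>i. ((*v) A ^^ i) v) ` {..<k})"
    define T1 where "T1 = (\<Union>(v, k)\<in>set ps. (\<lambda>i. ((*v) A ^^ i) (u v)) ` {..<k})"
    have T_eq: "T = (\<Union>(v, k)\<in>set ps. (\<lambda>i. ((*v) A ^^ i) (u v)) ` {..<Suc k}) \<union> Z"
      by (force simp: T_def qs_def zs)
    have "(\<lambda>(v, k). ((*v) A ^^ (k - 1)) v) ` set qs =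
        (\<lambda>(v, k). ((*v) A ^^ k) (u v)) ` set ps \<union> Z"
      by (force simp: qs_def zs)
    also have "(\<lambda>(v, k). ((*v) A ^^ k) (u v)) ` set ps = (\<lambda>(v, k). ((*v) A ^^ (k - 1)) v) ` set ps"
    proof (rule image_cong[OF refl])
      fix p assume p: "p \<in> set ps"
      obtain v k where [simp]: "p = (v, k)" by (cases p)
      have "Suc (k - 1) = k" using ps1 p by auto
      then show "(case p of (v, k) \<Rightarrow> ((*v) A ^^ k) (u v)) = (case p of (v, k) \<Rightarrow> ((*v) A ^^ (k - 1)) v)"
        using shift[of v k "k - 1"] p by simp
    qed
    finally have lasts: "(\<lambda>(v, k). ((*v) A ^^ (k - 1)) v) ` set qs =
        (\<lambda>(v, k). ((*v) A ^^ (k - 1)) v) ` set ps \<union> Z" .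
    have spanN: "vec.span ((\<lambda>(v, k). ((*v) A ^^ (k - 1)) v) ` set qs) = N"
      unfolding lasts Z(3)[symmetric] ps3[symmetric] vec.span_Un vec.span_span by (rule refl)
    have qs1: "\<forall>(v, k)\<in>set qs. k \<ge> 1" by (auto simp: qs_def)
    have "(\<lambda>(v, k). ((*v) A ^^ (k - 1)) v) ` set qs \<subseteq> T"
      using qs1 by (fastforce simp: T_def)
    then have NT: "N \<subseteq> vec.span T" using spanN vec.span_mono by blast
    have "T \<subseteq> W"
    proof -
      have "((*v) A ^^ i) (u v) \<in> W" if "(v, k) \<in> set ps" "i < Suc k" for v k i
        using that u[OF that(1)] mem[OF that(1)] shift[OF that(1)] W' by (cases i) auto
      then show ?thesis using Z(2) by (auto simp: T_eq N_def)
    qed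
    have "(*v) A ` T1 = (\<Union>(v, k)\<in>set ps. (\<lambda>i. ((*v) A ^^ i) v) ` {..<k})"
      unfolding T1_def image_UN using shift by (intro SUP_cong refl) (auto simp: image_image)
    then have AT1: "(*v) A ` vec.span T1 = W'" 
      using vec.span_image[of A T1] ps2 by simp
    have T1T: "vec.span T1 \<subseteq> vec.span T"
    proof (rule vec.span_mono)
      have "T1 \<subseteq> (\<Union>(v, k)\<in>set ps. (\<lambda>i. ((*v) A ^^ i) (u v)) ` {..<Suc k})"
        unfolding T1_def by (rule UN_mono) (auto intro!: imageI)
      then show "T1 \<subseteq> T" unfolding T_eq by blast
    qed
    \<comment> \<open>\<open>A\<close> maps \<open>T1\<close>, the prolonged chains without their
      last vectors, onto the chains of \<open>W'\<close>. So each \<open>x\<close> in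
      \<open>W\<close> has the image of some \<open>y\<close> in the span of \<open>T1\<close>, and
      \<open>x - y\<close> lies in \<open>N\<close>.\<close>
    have "W \<subseteq> vec.span T"
    proof
      fix x assume x: "x \<in> W"
      then have "A *v x \<in> (*v) A ` vec.span T1" using AT1 by (auto simp: W'_def)
      then obtain y where y: "y \<in> vec.span T1" "A *v x = A *v y" by auto
      have "y \<in> W" using y T1T \<open>T \<subseteq> W\<close> W vec.span_minimal by blast
      then have "x - y \<in> N" using x y W by (simp add: N_def vec.diff vec.subspace_diff)
      then have "(x - y) + y \<in> vec.span T" using NT T1T y by (blast intro: vec.span_add)
      then show "x \<in> vec.span T" by simp
    qed
    then have spanT: "vec.span T = W" using \<open>T \<subseteq> W\<close> W by (simp add: vec.span_subspace)
    have len: "length qs \<le> vec.dim N" using ps4 Z(4) by (simp add: qs_def zs)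
    \<comment> \<open>Every old chain grows by one vector and every \<open>z\<close> adds one;
      rank-nullity then bounds the total by the dimension of \<open>W\<close>. Independence will
      follow from this count.\<close>
    have "sum_list (map snd qs) = sum_list (map snd ps) + length ps + card Z"
    proof -
      have "sum_list (map (\<lambda>(v, k). Suc k) ps) = sum_list (map snd ps) + length ps"
        by (induction ps) auto
      moreover have "sum_list (map (\<lambda>z. 1) zs) = length zs" by (induction zs) auto
      ultimately show ?thesis by (simp add: qs_def zs o_def case_prod_unfold)
    qed
    also have "\<dots> \<le> vec.dim W' + vec.dim N" using ps4 ps5 Z(4) by simp
    also have "\<dots> = vec.dim W" 
      using dim_image_add_kernel[OF W(1), of A] by (simp add: W'_def N_def)
    finally have sum: "sum_list (map snd qs) \<le> vec.dim W" .
    show ?thesis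
      using qs1 spanT spanN len sum unfolding T_def N_def by blast
  qed
qed

text \<open>The chains span the space with at most as many vectors as its dimension, which forces
  them to be distinct and independent.\<close>

lemma nilpotent_coherent_decomposition:
  fixes A :: "'a::field ^ 'n ^ 'n"
  assumes "A \<in> V" and nil: "\<And>U. vec.subspace U \<Longrightarrow> (*v) A ` U = U \<Longrightarrow> U \<subseteq> {0}"
  shows "\<exists>cs. coherent_decomposition V cs \<and> length cs \<le> vec.dim {x. A *v x = 0}"
proof -
  obtain ps where ps1: "\<forall>(v, k)\<in>set ps. k \<ge> 1" and
    ps2: "vec.span (\<Union>(v, k)\<in>set ps. (\<lambda>i. ((*v) A ^^ i) v) ` {..<k}) = UNIV" and
    ps3: "length ps \<le> vec.dim {x. A *v x = 0}" and
    ps4: "sum_list (map snd ps) \<le> vec.dim (UNIV :: ('a ^ 'n) set)"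
    using nilpotent_chain_basis[of UNIV A] nil by auto
  define cs where "cs = map (\<lambda>(v, k). map (\<lambda>i. ((*v) A ^^ i) v) [0..<k]) ps"
  let ?B = "set (concat cs)"
  have set: "?B = (\<Union>(v, k)\<in>set ps. (\<lambda>i. ((*v) A ^^ i) v) ` {..<k})"
    by (force simp: cs_def)
  have "length (concat cs) = sum_list (map snd ps)"
    unfolding cs_def by (induction ps) auto
  then have len: "length (concat cs) \<le> vec.dim (UNIV :: ('a ^ 'n) set)" using ps4 by simp
  have span: "vec.span ?B = UNIV" using ps2 set by simp
  then have ge: "vec.dim (UNIV :: ('a ^ 'n) set) \<le> card ?B" by (intro vec.dim_le_card) auto
  have "card ?B = length (concat cs)" using len ge card_length[of "concat cs"] by linarith
  then have dist: "distinct (concat cs)" by (rule card_distinct)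
  have ind: "vec.independent ?B"
    using span len card_length[of "concat cs"]
    by (intro vec.card_le_dim_spanning[of _ UNIV]) auto
  have chain: "chain_implemented_by A c" if "c \<in> set cs" for c
    using that ps1 unfolding cs_def chain_implemented_by_def by fastforce
  have "coherent_decomposition V cs"
    unfolding coherent_decomposition_def coherent_chain_def
    using chain dist ind span \<open>A \<in> V\<close> by blast
  then show ?thesis using ps3 by (auto simp: cs_def)
qed

lemma distinct_concat_tl:
  "distinct (concat cs) \<Longrightarrow> distinct (concat (map tl cs)) \<and> set (concat (map tl cs)) \<subseteq> set (concat cs)"
proof (induction cs)
  case (Cons c cs)
  have "set (tl c) \<subseteq> set c" by (cases c) auto
  moreover have "distinct (concat cs)" "distinct c" "set c \<inter> set (concat cs) = {}"
    using Cons.prems by auto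
  moreover note Cons.IH[OF this(1)]
  ultimately show ?case by (auto simp: distinct_tl simp del: set_concat)
qed simp

text \<open>All vectors of a chain but the first lie in the range of \<open>A\<close>; being part of
  a basis, these bound the rank from below.\<close>

lemma dim_range_chains_ge:
  fixes A :: "'a::field ^ 'n ^ 'n"
  assumes "\<forall>c\<in>set cs. chain_implemented_by A c" and dist: "distinct (concat cs)"
    and ind: "vec.independent (set (concat cs))" and span: "vec.span (set (concat cs)) = UNIV"
  shows "CARD('n) \<le> vec.dim (range ((*v) A)) + length cs"
proof -
  let ?T = "concat (map tl cs)"
  have "c \<noteq> [] \<and> set (tl c) \<subseteq> range ((*v) A)" if "c \<in> set cs" for c
  proof -
    have "chain_implemented_by A c" using assms(1) that by blast
    then obtain v k where "k \<ge> 1" and c: "c = map (\<lambda>i. ((*v) A ^^ i) v) [0..<k]"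
      unfolding chain_implemented_by_def by blast
    then obtain m where "k = Suc m" by (cases k) auto
    then have "tl c = map (\<lambda>i. ((*v) A ^^ Suc i) v) [0..<m]"
      unfolding c by (simp add: map_tl[symmetric] map_Suc_upt[symmetric] o_def del: upt_Suc map_Suc_upt)
    then show ?thesis using c \<open>k \<ge> 1\<close> by auto
  qed
  then have ne: "\<forall>c\<in>set cs. c \<noteq> []" and sub: "set ?T \<subseteq> range ((*v) A)" by auto
  have "length (concat cs) = length ?T + length cs"
    using ne by (induction cs) (auto simp: neq_Nil_conv)
  moreover have "length (concat cs) = CARD('n)"
    using distinct_card[OF dist] vec.dim_eq_card[of "set (concat cs)" UNIV] ind span
    by (simp add: vec_dim_card card_cart_basis del: set_concat)
  moreover have "length ?T = card (set ?T)" "vec.independent (set ?T)"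
    using distinct_concat_tl[OF dist] vec.independent_mono[OF ind] distinct_card by metis+
  ultimately show ?thesis using vec.independent_card_le_dim[OF sub] by simp
qed

section \<open>Matroid intersection\<close>

text \<open>The dual object of matroid intersection: a splitting of \<open>E\<close> into two parts,
  with the spans of the \<open>v\<close> of one part and of the \<open>w\<close> of the other
  enlarged to arbitrary subspaces.\<close>

definition covers :: "(('a::field ^ 'n) \<times> ('a ^ 'n)) set \<Rightarrow> ('a ^ 'n) set \<Rightarrow> ('a ^ 'n) set \<Rightarrow> bool" where
  "covers E X Y \<longleftrightarrow> vec.subspace X \<and> vec.subspace Y \<and> (\<forall>(v, w)\<in>E. v \<in> X \<or> w \<in> Y)"

lemma subset_sums:
  fixes S T :: "('a::field ^ 'n) set"
  assumes "vec.subspace S" "vec.subspace T"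
  shows "S \<union> T \<subseteq> {x + y |x y. x \<in> S \<and> y \<in> T}"
proof -
  have "x = x + 0" "x = 0 + x" for x :: "'a ^ 'n" by auto
  then show ?thesis using assms vec.subspace_0 by blast
qed

text \<open>Uncrossing: a first vector outside \<open>X1 + X2\<close> lies in neither summand, so
  its partner is in both \<open>Y1\<close> and \<open>Y2\<close>; the second cover is symmetric. The
  new pair is covered through \<open>X2\<close> in one and \<open>Y2\<close> in the other.\<close>

lemma covers_modular:
  assumes "covers E X1 Y1" "covers E X2 Y2" "v \<in> X2" "w \<in> Y2"
  shows "covers (insert (v, w) E) {x + y |x y. x \<in> X1 \<and> y \<in> X2} (Y1 \<inter> Y2)"
    and "covers (insert (v, w) E) (X1 \<inter> X2) {x + y |x y. x \<in> Y1 \<and> y \<in> Y2}"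
proof -
  have sub: "vec.subspace X1" "vec.subspace X2" "vec.subspace Y1" "vec.subspace Y2"
    using assms by (auto simp: covers_def)
  show "covers (insert (v, w) E) {x + y |x y. x \<in> X1 \<and> y \<in> X2} (Y1 \<inter> Y2)"
    using assms subset_sums[OF sub(1,2)] vec.subspace_sums[OF sub(1,2)] vec.subspace_inter[OF sub(3,4)]
    unfolding covers_def by blast
  show "covers (insert (v, w) E) (X1 \<inter> X2) {x + y |x y. x \<in> Y1 \<and> y \<in> Y2}"
    using assms subset_sums[OF sub(3,4)] vec.subspace_sums[OF sub(3,4)] vec.subspace_inter[OF sub(1,2)]
    unfolding covers_def by blast
qed

text \<open>The subspaces \<open>P\<close> and \<open>Q\<close> play the role of contracted elements in the usual
  deletion-contraction proof. If neither deleting nor contracting \<open>e\<close> works, the two resulting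
  covers combine, by modularity of the dimension, into a cover of \<open>insert e E\<close> that is too small.\<close>

lemma vector_matroid_intersection:
  fixes E :: "(('a::field ^ 'n) \<times> ('a ^ 'n)) set"
  assumes "finite E"
    and "\<And>X Y. covers E X Y \<Longrightarrow> P \<subseteq> X \<Longrightarrow> Q \<subseteq> Y \<Longrightarrow>
           vec.dim P + vec.dim Q + k \<le> vec.dim X + vec.dim Y"
  shows "\<exists>I\<subseteq>E. card I = k \<and> vec.dim (P \<union> fst ` I) = vec.dim P + k \<and>
           vec.dim (Q \<union> snd ` I) = vec.dim Q + k"
  using assms
proof (induction E arbitrary: P Q k rule: finite_induct)
  case empty
  have "k = 0" using empty[of "vec.span P" "vec.span Q"] by (simp add: covers_def vec.span_superset)
  then show ?case by simp
next
  case (insert e E)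
  obtain v w where e: "e = (v, w)" by (cases e)
  show ?case
  proof (cases "\<forall>X Y. covers E X Y \<longrightarrow> P \<subseteq> X \<longrightarrow> Q \<subseteq> Y \<longrightarrow>
           vec.dim P + vec.dim Q + k \<le> vec.dim X + vec.dim Y")
    case True
    then show ?thesis using insert.IH[of P Q k] by (meson subset_insertI2)
  next
    case False
    then obtain X1 Y1 where 1: "covers E X1 Y1" "P \<subseteq> X1" "Q \<subseteq> Y1"
      "vec.dim X1 + vec.dim Y1 < vec.dim P + vec.dim Q + k" by force
    have sub1: "vec.subspace X1" "vec.subspace Y1" using 1 by (auto simp: covers_def)
    \<comment> \<open>If \<open>v\<close> or \<open>w\<close> were contained, \<open>X1\<close> and
      \<open>Y1\<close> would already cover \<open>insert e E\<close>, with too small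
      dimensions.\<close>
    have "v \<notin> X1" "w \<notin> Y1"
      using 1 insert.prems[of X1 Y1] by (auto simp: covers_def e)
    then have vw: "v \<notin> vec.span P" "w \<notin> vec.span Q"
      using vec.span_minimal sub1 1 by blast+
    then have dim: "vec.dim (insert v P) = Suc (vec.dim P)" "vec.dim (insert w Q) = Suc (vec.dim Q)"
      by (simp_all add: vec.dim_insert)
    have "vec.dim P \<le> vec.dim X1" "vec.dim Q \<le> vec.dim Y1"
      using 1 by (simp_all add: vec.dim_subset)
    then obtain l where l: "k = Suc l" using 1(4) by (cases k) auto
    have "vec.dim (insert v P) + vec.dim (insert w Q) + l \<le> vec.dim X2 + vec.dim Y2"
      if 2: "covers E X2 Y2" "insert v P \<subseteq> X2" "insert w Q \<subseteq> Y2" for X2 Y2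
    proof (rule ccontr)
      assume neg: "\<not> ?thesis"
      have sub2: "vec.subspace X2" "vec.subspace Y2" using 2 by (auto simp: covers_def)
      let ?X = "{x + y |x y. x \<in> X1 \<and> y \<in> X2}" and ?Y = "{x + y |x y. x \<in> Y1 \<and> y \<in> Y2}"
      have "covers (insert e E) ?X (Y1 \<inter> Y2)" "covers (insert e E) (X1 \<inter> X2) ?Y"
        unfolding e using covers_modular[OF 1(1) 2(1)] 2 by blast+
      moreover have "P \<subseteq> ?X" "Q \<subseteq> ?Y"
        using subset_sums[OF sub1(1) sub2(1)] subset_sums[OF sub1(2) sub2(2)] 1 by blast+
      ultimately have "vec.dim P + vec.dim Q + k \<le> vec.dim ?X + vec.dim (Y1 \<inter> Y2)"
        "vec.dim P + vec.dim Q + k \<le> vec.dim (X1 \<inter> X2) + vec.dim ?Y"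
        using 1 2 by (intro insert.prems; blast)+
      \<comment> \<open>The first cover has dimension sum at most \<open>p + q + k - 1\<close> and
        the second at most \<open>p + q + k\<close>, where \<open>p\<close>, \<open>q\<close> are
        the dimensions of \<open>P\<close>, \<open>Q\<close>. The combined covers have the same
        total but need \<open>2 * (p + q + k)\<close>.\<close>
      then show False
        using neg 1(4) dim l vec.dim_sums_Int[OF sub1(1) sub2(1)] vec.dim_sums_Int[OF sub1(2) sub2(2)]
        by linarith
    qed
    from insert.IH[OF this] obtain I where I: "I \<subseteq> E" "card I = l"
      "vec.dim (insert v P \<union> fst ` I) = vec.dim (insert v P) + l"
      "vec.dim (insert w Q \<union> snd ` I) = vec.dim (insert w Q) + l" by blast
    have "e \<notin> I" "finite I" using I insert finite_subset by auto
    then show ?thesis using I dim l e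
      by (intro exI[of _ "insert e I"]) auto
  qed
qed

text \<open>Take a cover with the least sum of dimensions, and apply the previous lemma with
  \<open>P\<close> and \<open>Q\<close> empty and \<open>k\<close> this sum.\<close>

corollary ex_minimal_cover:
  fixes E :: "(('a::field ^ 'n) \<times> ('a ^ 'n)) set"
  assumes "finite E"
  shows "\<exists>X Y I. covers E X Y \<and> I \<subseteq> E \<and> card I = vec.dim X + vec.dim Y \<and>
           vec.dim (fst ` I) = card I \<and> vec.dim (snd ` I) = card I"
proof -
  have "covers E UNIV UNIV" by (auto simp: covers_def)
  then obtain p where p: "covers E (fst p) (snd p)"
    "\<And>q. covers E (fst q) (snd q) \<Longrightarrow>
      vec.dim (fst p) + vec.dim (snd p) \<le> vec.dim (fst q) + vec.dim (snd q)"
    using ex_has_least_nat[of "\<lambda>p. covers E (fst p) (snd p)" "(UNIV, UNIV)"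
        "\<lambda>p. vec.dim (fst p) + vec.dim (snd p)"] by auto
  have "\<exists>I\<subseteq>E. card I = vec.dim (fst p) + vec.dim (snd p) \<and>
      vec.dim ({} \<union> fst ` I) = vec.dim ({} :: ('a ^ 'n) set) + (vec.dim (fst p) + vec.dim (snd p)) \<and>
      vec.dim ({} \<union> snd ` I) = vec.dim ({} :: ('a ^ 'n) set) + (vec.dim (fst p) + vec.dim (snd p))"
    by (rule vector_matroid_intersection[OF assms]) (use p(2)[of "(X, Y)" for X Y] in simp)
  then obtain I where "I \<subseteq> E" "card I = vec.dim (fst p) + vec.dim (snd p)"
    "vec.dim (fst ` I) = card I" "vec.dim (snd ` I) = card I" by auto
  then show ?thesis using p(1) by blast
qed

section \<open>The matrix space of a linorder\<close>

lemma sum_matrix_mult_vec: "(\<Sum>i\<in>I. M i) *v x = (\<Sum>i\<in>I. M i *v x)"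
  by (induction I rule: infinite_finite_induct) (auto simp: matrix_vector_mult_add_rdistrib)

lemma mat_scale_mult_vec: "mat_scale c M *v x = c *s (M *v x)"
  by (simp add: vec_eq_iff mat_scale_def matrix_vector_mult_def sum_distrib_left mult_ac)

text \<open>As the vectors \<open>w\<close> are independent, the sum of the \<open><x,v> w\<close>
  vanishes only if \<open>x\<close> is orthogonal to every \<open>v\<close>.\<close>

lemma matching_kernel_le:
  fixes I :: "(('a::conjugatable_ordered_field ^ 'n) \<times> ('a ^ 'n)) set"
  assumes "finite I" "vec.dim (fst ` I) = card I" "vec.dim (snd ` I) = card I"
  shows "vec.dim {x. (\<Sum>e\<in>I. outer (snd e) (fst e)) *v x = 0} + card I \<le> CARD('n)"
proof -
  have "card I \<le> card (snd ` I)"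
    unfolding assms(3)[symmetric] using assms(1) by (intro vec.dim_le_card) (auto intro: vec.span_base)
  then have card: "card (snd ` I) = card I" using card_image_le[OF assms(1), of snd] by linarith
  then have inj: "inj_on snd I" by (rule eq_card_imp_inj_on[OF assms(1)])
  have ind: "vec.independent (snd ` I)"
    using card assms by (intro vec.card_le_dim_spanning[of _ "snd ` I"]) (auto intro: vec.span_base)
  have "{x. (\<Sum>e\<in>I. outer (snd e) (fst e)) *v x = 0} \<subseteq> orth (fst ` I)"
  proof
    fix x assume "x \<in> {x. (\<Sum>e\<in>I. outer (snd e) (fst e)) *v x = 0}"
    then have "(\<Sum>e\<in>I. std_inner x (fst e) *s snd e) = 0"
      by (simp add: sum_matrix_mult_vec outer_mult_vec)
    \<comment> \<open>Injectivity of \<open>snd\<close> on \<open>I\<close> turns the sum into one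
      indexed by the vectors \<open>w\<close>, to which independence applies.\<close>
    then have "(\<Sum>w\<in>snd ` I. std_inner x (fst (the_inv_into I snd w)) *s w) = 0"
      using inj by (simp add: sum.reindex the_inv_into_f_f cong: sum.cong)
    then have "std_inner x (fst (the_inv_into I snd w)) = 0" if "w \<in> snd ` I" for w
      using vec.independentD[OF ind _ subset_refl _ that] assms(1) by simp
    then have "std_inner x (fst e) = 0" if "e \<in> I" for e
      using the_inv_into_f_f[OF inj that] that by (metis imageI)
    then show "x \<in> orth (fst ` I)" by (auto simp: orth_def perp_def)
  qed
  then have "vec.dim {x. (\<Sum>e\<in>I. outer (snd e) (fst e)) *v x = 0} \<le> vec.dim (orth (fst ` I))"
    by (rule vec.dim_subset)
  moreover have "vec.dim (vec.span (fst ` I)) + vec.dim (orth (fst ` I)) \<le> CARD('n)"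
  proof -
    let ?D = "{x + y |x y. x \<in> vec.span (fst ` I) \<and> y \<in> orth (fst ` I)}"
    have "vec.dim ?D = vec.dim (vec.span (fst ` I)) + vec.dim (orth (fst ` I))"
      by (rule dim_orthogonal_add) (auto simp: orth_span subspace_orth)
    moreover have "vec.dim ?D \<le> vec.dim (UNIV :: ('a ^ 'n) set)" by (rule vec.dim_subset) simp
    ultimately show ?thesis by (simp add: vec_dim_card card_cart_basis)
  qed
  ultimately show ?thesis using assms by simp
qed

text \<open>The matrix units \<open>e p\<close> form a finite spanning set. This is what later
  reduces an infinite \<open>R\<close> to finitely many pairs.\<close>

lemma finite_mat_vs_independent:
  fixes S :: "('a::field ^ 'n ^ 'n) set"
  assumes "mat_vs.independent S"
  shows "finite S"
proof -
  define e :: "'n \<times> 'n \<Rightarrow> 'a ^ 'n ^ 'n"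
    where "e = (\<lambda>p. \<chi> i j. if (i, j) = p then 1 else 0)"
  have "M \<in> mat_vs.span (range e)" for M
  proof -
    have "M = (\<Sum>p\<in>UNIV. mat_scale (M $ fst p $ snd p) (e p))"
    proof (intro vec_eq_iff[THEN iffD2] allI)
      fix i j
      have "(\<Sum>p\<in>UNIV. mat_scale (M $ fst p $ snd p) (e p)) $ i $ j =
          (\<Sum>p\<in>UNIV. if p = (i, j) then M $ i $ j else 0)"
        unfolding sum_component by (intro sum.cong) (auto simp: mat_scale_def e_def)
      then show "M $ i $ j = (\<Sum>p\<in>UNIV. mat_scale (M $ fst p $ snd p) (e p)) $ i $ j" by simp
    qed
    also have "\<dots> \<in> mat_vs.span (range e)"
      by (intro mat_vs.span_sum mat_vs.span_scale mat_vs.span_base rangeI)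
    finally show ?thesis .
  qed
  then show ?thesis using mat_vs.independent_span_bound[OF _ assms, of "range e"] by auto
qed

lemma linorder_space_eq: "linorder_space R = mat_vs.span ((\<lambda>e. outer (snd e) (fst e)) ` R)"
  unfolding linorder_space_def by (rule arg_cong[of _ _ mat_vs.span]) force

text \<open>Each generator sends \<open>x\<close> to a multiple of \<open>w\<close>, which is zero
  if \<open>x\<close> is orthogonal to \<open>v\<close>; membership in \<open>D\<close> passes to
  linear combinations.\<close>

lemma span_outer_mult_vec:
  assumes "A \<in> mat_vs.span ((\<lambda>e. outer (snd e) (fst e)) ` E)" and D: "vec.subspace D"
    and "\<And>v w. (v, w) \<in> E \<Longrightarrow> perp x v \<or> w \<in> D"
  shows "A *v x \<in> D"
  using assms(1)
proof (rule mat_vs.span_induct)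
  show "mat_vs.subspace {A. A *v x \<in> D}"
    using D by (auto simp: mat_vs.subspace_def vec.subspace_def mat_scale_mult_vec
        matrix_vector_mult_add_rdistrib)
  show "B *v x \<in> D" if "B \<in> (\<lambda>e. outer (snd e) (fst e)) ` E" for B
    using that assms(3) D by (force simp: outer_mult_vec perp_def vec.subspace_scale vec.subspace_0)
qed

lemma linorder_space_finite_span:
  assumes "A \<in> linorder_space R"
  obtains E where "finite E" "E \<subseteq> R" "A \<in> mat_vs.span ((\<lambda>e. outer (snd e) (fst e)) ` E)"
proof -
  obtain t r where t: "finite t" "t \<subseteq> (\<lambda>e. outer (snd e) (fst e)) ` R"
    and A: "A = (\<Sum>a\<in>t. mat_scale (r a) a)"
    using assms unfolding linorder_space_eq mat_vs.span_explicit by blast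
  obtain E where E: "E \<subseteq> R" "finite E" "t = (\<lambda>e. outer (snd e) (fst e)) ` E"
    using finite_subset_image[OF t] by blast
  have "A \<in> mat_vs.span t"
    unfolding A by (intro mat_vs.span_sum mat_vs.span_scale mat_vs.span_base)
  with E that show thesis by blast
qed

text \<open>The relation \<open>w \<not>\<perp> v'\<close> between pairs \<open>(v, w)\<close> and \<open>(v', w')\<close> of a linorder has no cycles:
  by transitivity a cycle through \<open>(v, w)\<close> collapses to a pair \<open>(v, w')\<close> in the linorder with
  \<open>w' \<not>\<perp> v\<close>. If \<open>A U = U \<noteq> 0\<close>, every pair of a finite set generating \<open>A\<close> that acts
  nontrivially on \<open>U\<close> has a predecessor of the same kind.\<close>

lemma linorder_space_nilpotent:
  assumes R: "is_linorder R" and A: "A \<in> linorder_space R" and U: "(*v) A ` U = U"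
  shows "U \<subseteq> {0}"
proof -
  obtain E where E: "finite E" "E \<subseteq> R" "A \<in> mat_vs.span ((\<lambda>e. outer (snd e) (fst e)) ` E)"
    using linorder_space_finite_span[OF A] .
  define r where "r = {(e, f). e \<in> E \<and> f \<in> E \<and> \<not> perp (snd e) (fst f)}"
  have step: "\<exists>w. (fst e, w) \<in> R \<and> \<not> perp w (fst f)" if "(e, f) \<in> r\<^sup>+" for e f
    using that
  proof induction
    case (base f)
    then show ?case using E by (intro exI[of _ "snd e"]) (auto simp: r_def)
  next
    case (step f g)
    then obtain w where "(fst e, w) \<in> R" "\<not> perp w (fst f)" by blast
    moreover have "(fst f, snd f) \<in> R" "\<not> perp (snd f) (fst g)" using step E by (auto simp: r_def)
    ultimately show ?case using R unfolding is_linorder_def by blast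
  qed
  have "acyclic r"
    unfolding acyclic_def
  proof (intro allI notI)
    fix e assume "(e, e) \<in> r\<^sup>+"
    then obtain w where "(fst e, w) \<in> R" "\<not> perp w (fst e)" using step by blast
    then show False using R perp_commute[of w "fst e"] unfolding is_linorder_def by blast
  qed
  moreover have "finite r" using E by (auto simp: r_def intro: finite_subset[of _ "E \<times> E"])
  ultimately have wf: "wf r" by (rule finite_acyclic_wf[rotated])
  define S where "S = {e \<in> E. \<exists>u\<in>U. \<not> perp u (fst e)}"
  \<comment> \<open>Since \<open>U = A U\<close>, each \<open>u\<close> is \<open>A x\<close> with
    \<open>x\<close> in \<open>U\<close>, and only pairs of \<open>S\<close> contribute to
    \<open>A x\<close>.\<close>
  have US: "u \<in> vec.span (snd ` S)" if u: "u \<in> U" for u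
  proof -
    obtain x where x: "x \<in> U" "u = A *v x" using U u by blast
    show ?thesis unfolding x(2)
      by (rule span_outer_mult_vec[OF E(3)]) (use x in \<open>force simp: S_def intro!: vec.span_base\<close>)+
  qed
  have "S = {}"
  proof (rule ccontr)
    assume "S \<noteq> {}"
    then obtain f where f: "f \<in> S" "\<And>e. (e, f) \<in> r \<Longrightarrow> e \<notin> S"
      using wfE_min'[OF wf] by blast
    then obtain u where u: "u \<in> U" "\<not> perp u (fst f)" by (auto simp: S_def)
    \<comment> \<open>Minimality of \<open>f\<close> makes all second vectors of \<open>S\<close>
      orthogonal to \<open>fst f\<close>; then so is all of \<open>U\<close>, against
      \<open>f\<close> in \<open>S\<close>.\<close>
    have "vec.span (snd ` S) \<subseteq> {x. perp x (fst f)}"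
      using f by (intro vec.span_minimal subspace_perp) (auto simp: r_def S_def)
    then show False using US u by blast
  qed
  then show ?thesis using US by auto
qed

section \<open>Antichains and decompositions\<close>

text \<open>With \<open>U\<close> spanned by the vectors \<open>w\<close> of the pairs \<open>(v, w)\<close> that act nontrivially on the
  antichain \<open>C\<close>, every matrix of the space maps \<open>C + U\<close> into \<open>U \<subseteq> C\<^sup>\<perp>\<close>. So its kernel has
  dimension at least \<open>dim C\<close>.\<close>

lemma dim_antichain_le_length:
  fixes R :: "(('a::conjugatable_ordered_field ^ 'n) \<times> ('a ^ 'n)) set"
  assumes R: "is_linorder R" and C: "antichain R C"
    and cs: "coherent_decomposition (linorder_space R) cs"
  shows "vec.dim C \<le> length cs"
proof -
  obtain A where A: "A \<in> linorder_space R" "\<forall>c\<in>set cs. chain_implemented_by A c"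
    using cs unfolding coherent_decomposition_def by blast
  define S where "S = {e \<in> R. \<exists>c\<in>C. \<not> perp c (fst e)}"
  define U where "U = vec.span (snd ` S)"
  define W where "W = {x + y |x y. x \<in> C \<and> y \<in> U}"
  have sub: "vec.subspace C" "vec.subspace U" using C by (auto simp: antichain_def U_def)
  have "snd ` S \<subseteq> orth C"
  proof
    fix w assume "w \<in> snd ` S"
    then obtain v c where "(v, w) \<in> R" "c \<in> C" "\<not> perp c v" by (auto simp: S_def)
    then have "\<forall>c\<in>C. perp w c" using C perp_commute[of c v] unfolding antichain_def by blast
    then show "w \<in> orth C" by (simp add: orth_def)
  qed
  then have "U \<subseteq> orth C" unfolding U_def by (intro vec.span_minimal subspace_orth)
  then have dimW: "vec.dim W = vec.dim C + vec.dim U"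
    unfolding W_def by (rule dim_orthogonal_add[OF sub])
  have "(*v) A ` W \<subseteq> U"
  proof
    fix z assume "z \<in> (*v) A ` W"
    then obtain c u where z: "z = A *v (c + u)" "c \<in> C" "u \<in> U" by (auto simp: W_def)
    show "z \<in> U" unfolding z(1)
    proof (rule span_outer_mult_vec[OF A(1)[unfolded linorder_space_eq] sub(2)])
      fix v w assume vw: "(v, w) \<in> R"
      have in_U: "w \<in> U" if "(v', w) \<in> S" for v'
        unfolding U_def using that by (force intro: vec.span_base)
      show "perp (c + u) v \<or> w \<in> U"
      proof (rule disjCI)
        assume w: "w \<notin> U"
        then have "perp c v" using vw z(2) in_U[of v] by (auto simp: S_def)
        \<comment> \<open>Otherwise transitivity puts \<open>(fst e, w)\<close> in \<open>R\<close>;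
          it acts nontrivially on \<open>C\<close> because \<open>e\<close> does, so
          \<open>w\<close> would lie in \<open>U\<close>.\<close>
        moreover have "snd ` S \<subseteq> {x. perp x v}"
        proof (rule image_subsetI, rule CollectI, rule ccontr)
          fix e assume e: "e \<in> S" "\<not> perp (snd e) v"
          have "(fst e, snd e) \<in> R" using e(1) by (simp add: S_def)
          then have "(fst e, w) \<in> R" using R vw e(2) unfolding is_linorder_def by blast
          then have "(fst e, w) \<in> S" using e(1) by (auto simp: S_def)
          then show False using w in_U by blast
        qed
        then have "U \<subseteq> {x. perp x v}" unfolding U_def by (intro vec.span_minimal subspace_perp)
        then have "perp u v" using z(3) by blast
        ultimately show "perp (c + u) v" by (simp add: perp_def std_inner_add_left)
      qed
    qed
  qed
  moreover have "vec.subspace W" unfolding W_def by (rule vec.subspace_sums[OF sub])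
  \<comment> \<open>The dimension of \<open>U\<close> occurs on both sides of the bound and
    cancels.\<close>
  ultimately have "vec.dim (range ((*v) A)) + vec.dim C \<le> CARD('n)"
    using dim_range_le[of W A U] dimW by simp
  moreover have "CARD('n) \<le> vec.dim (range ((*v) A)) + length cs"
    using dim_range_chains_ge[OF A(2)] cs by (simp add: coherent_decomposition_def)
  ultimately show ?thesis by linarith
qed

text \<open>The cover only concerns \<open>E\<close>, but every \<open>outer w v\<close> with
  \<open>(v, w)\<close> in \<open>R\<close> is a combination of the matrices from \<open>E\<close>.
  Each of these sends \<open>C = orth (X \<union> Y)\<close> into \<open>orth C\<close>: it kills
  \<open>C\<close> if its \<open>v'\<close> is in \<open>X\<close>, and otherwise \<open>w'\<close>
  is in \<open>Y\<close>. So \<open><c,v> w\<close> is in \<open>orth C\<close> for \<open>c\<close>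
  in \<open>C\<close>.\<close>

lemma antichain_of_cover:
  fixes R :: "(('a::conjugatable_field ^ 'n) \<times> ('a ^ 'n)) set"
  assumes cov: "covers E X Y"
    and span: "linorder_space R \<subseteq> mat_vs.span ((\<lambda>e. outer (snd e) (fst e)) ` E)"
  shows "antichain R (orth (X \<union> Y))"
proof -
  let ?C = "orth (X \<union> Y)"
  have "(\<forall>c\<in>?C. perp v c) \<or> (\<forall>c\<in>?C. perp w c)" if vw: "(v, w) \<in> R" for v w
  proof (rule disjCI)
    assume "\<not> (\<forall>c\<in>?C. perp w c)"
    then have w: "w \<notin> orth ?C" by (simp add: orth_def)
    have "outer w v \<in> linorder_space R"
      unfolding linorder_space_def using vw by (intro mat_vs.span_base) blast
    then have A: "outer w v \<in> mat_vs.span ((\<lambda>e. outer (snd e) (fst e)) ` E)" using span by blast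
    show "\<forall>c\<in>?C. perp v c"
    proof
      fix c assume c: "c \<in> ?C"
      have "outer w v *v c \<in> orth ?C"
      proof (rule span_outer_mult_vec[OF A subspace_orth])
        fix v' w' assume "(v', w') \<in> E"
        then have "v' \<in> X \<or> w' \<in> Y" using cov by (auto simp: covers_def)
        then show "perp c v' \<or> w' \<in> orth ?C"
          using c perp_commute by (auto simp: orth_def)
      qed
      then have "std_inner c v *s w \<in> orth ?C" by (simp add: outer_mult_vec)
      then have "inverse (std_inner c v) *s (std_inner c v *s w) \<in> orth ?C"
        by (rule vec.subspace_scale[OF subspace_orth])
      then show "perp v c" using w perp_commute[of v c] by (auto simp: perp_def)
    qed
  qed
  then show ?thesis unfolding antichain_def using subspace_orth by blast
qed

text \<open>Antichain dimensions never exceed decomposition sizes, so one decomposition and one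
  antichain with equal values are both extremal.\<close>

theorem linear_dilworth:
  fixes R :: "(('a::conjugatable_ordered_field ^ 'n) \<times> ('a ^ 'n)) set"
  assumes R: "is_linorder R"
  shows "\<exists>cs C. is_arg_min length (coherent_decomposition (linorder_space R)) cs \<and>
           is_arg_max vec.dim (antichain R) C \<and> length cs = vec.dim C"
proof -
  let ?o = "\<lambda>e :: ('a ^ 'n) \<times> ('a ^ 'n). outer (snd e) (fst e)"
  obtain B where B: "B \<subseteq> ?o ` R" "mat_vs.independent B" "?o ` R \<subseteq> mat_vs.span B"
    using mat_vs.maximal_independent_subset by blast
  \<comment> \<open>Matroid intersection requires finitely many pairs, so \<open>R\<close> is
    replaced by pairs whose matrices form a basis of the space.\<close>
  obtain E where E: "E \<subseteq> R" "finite E" "B = ?o ` E"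
    using finite_subset_image[OF finite_mat_vs_independent[OF B(2)] B(1)] by blast
  have span: "linorder_space R \<subseteq> mat_vs.span (?o ` E)"
    unfolding linorder_space_eq using B(3) E(3) by (intro mat_vs.span_minimal) auto
  obtain X Y I where XY: "covers E X Y" and I: "I \<subseteq> E" "card I = vec.dim X + vec.dim Y"
    "vec.dim (fst ` I) = card I" "vec.dim (snd ` I) = card I"
    using ex_minimal_cover[OF E(2)] by blast
  define A where "A = (\<Sum>e\<in>I. ?o e)"
  have A: "A \<in> linorder_space R"
    unfolding A_def linorder_space_eq using I(1) E(1)
    by (intro mat_vs.span_sum mat_vs.span_base) blast
  have ker: "vec.dim {x. A *v x = 0} + card I \<le> CARD('n)"
    unfolding A_def using I E(2) finite_subset by (intro matching_kernel_le) auto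
  obtain cs where cs: "coherent_decomposition (linorder_space R) cs"
    "length cs \<le> vec.dim {x. A *v x = 0}"
    using nilpotent_coherent_decomposition[OF A] linorder_space_nilpotent[OF R A] by blast
  define C where "C = orth (X \<union> Y)"
  have C: "antichain R C" unfolding C_def by (rule antichain_of_cover[OF XY span])
  have "vec.dim (X \<union> Y) \<le> vec.dim X + vec.dim Y"
  proof -
    have sub: "vec.subspace X" "vec.subspace Y" using XY by (auto simp: covers_def)
    have "vec.span X = X" "vec.span Y = Y" using sub by (simp_all only: vec.span_eq_iff)
    then have "vec.dim (X \<union> Y) = vec.dim {x + y |x y. x \<in> X \<and> y \<in> Y}"
      using vec.dim_span[of "X \<union> Y"] by (simp only: vec.span_Un)
    then show ?thesis using vec.dim_sums_Int[OF sub] by simp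
  qed
  then have "CARD('n) \<le> vec.dim C + card I"
    using dim_orth_ge[of "X \<union> Y"] I(2) by (simp add: C_def)
  then have "length cs \<le> vec.dim C" using ker cs(2) by linarith
  then have eq: "length cs = vec.dim C" using dim_antichain_le_length[OF R C cs(1)] by simp
  show ?thesis
  proof (intro exI conjI)
    show "is_arg_min length (coherent_decomposition (linorder_space R)) cs"
      unfolding is_arg_min_linorder using cs(1) eq dim_antichain_le_length[OF R C] by auto
    show "is_arg_max vec.dim (antichain R) C"
      unfolding is_arg_max_linorder using C eq dim_antichain_le_length[OF R _ cs(1)] by auto
  qed (fact eq)
qed

theorem theorem1p15:
  shows "(\<forall>R :: ((real ^ 'n) \<times> (real ^ 'n)) set. is_linorder R \<longrightarrow>
            (\<exists>cs C. is_arg_min length (coherent_decomposition (linorder_space R)) cs \<and>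
                    is_arg_max vec.dim (antichain R) C \<and>
                    length cs = vec.dim C)) \<and>
         (\<forall>R :: ((complex ^ 'n) \<times> (complex ^ 'n)) set. is_linorder R \<longrightarrow>
            (\<exists>cs C. is_arg_min length (coherent_decomposition (linorder_space R)) cs \<and>
                    is_arg_max vec.dim (antichain R) C \<and>
                    length cs = vec.dim C))"
  by (intro conjI allI impI linear_dilworth)

end
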